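(* Let $(G,+)$ be a finite abelian group with identity $0$, $n$ a positive integer, $W=G\wr S_n$, let $\underline\sigma\in\Sigma_n(G)$ and let $Y$ be a nonempty subset of $W$ with inner distribution $(a_{\underline\lambda})_{\underline\lambda\in\Lambda_n(G)}$. Then $Y$ is a $\underline\sigma$-clique if and only if $a_{\underline\lambda}=0$ for all $\underline\lambda\in C(\underline\sigma)$ with $\underline\lambda(0)\neq(1^n)$.
   Context: $[n]=\{1,\dots,n\}$. $W=G\wr S_n$ consists of pairs $(g,\pi)$, $g\in G^n$, $\pi\in S_n$, with $(f,\pi)(g,\sigma)=(f+g^\pi,\pi\sigma)$, $g^\pi=(g_{\pi^{-1}(1)},\dots,g_{\pi^{-1}(n)})$. $\mathrm{Par}$ is the set of partitions; $(1^n)$ is the partition with $n$ parts equal to 1. $\Lambda_n(G)$: maps $\underline\lambda:G\to\mathrm{Par}$ with $\sum_g|\underline\lambda(g)|=n$; $\Sigma_n(G)$: maps $\underline\sigma$ from subgroups of $G$ to $\mathrm{Par}$ with $\sum_{U\le G}|\underline\sigma(U)|=n$. Tabloids: a $\underline\sigma$-tableau consists of, for each $U\le G$, the Young diagram of $\underline\sigma(U)$ with boxes filled by pairs $(c,i)$, $c\in G/U$, $i\in[n]$, all $i$ pairwise distinct; row-equivalence classes are $\underline\sigma$-tabloids; $W$ acts entrywise by $(g,\pi)\cdot(c,i)=(c+g_{\pi(i)},\pi(i))$. $H_{\underline\sigma}$ is the stabiliser of a fixed $\underline\sigma$-tabloid. A nonempty $Y\subseteq W$ is a $\underline\sigma$-clique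 if for all distinct $x,y\in Y$ no $\underline\sigma$-tabloid is fixed by $x^{-1}y$. Conjugacy classes: for $(g,\pi)\in W$ and a cycle $(i_1\dots i_k)$ of $\pi$, its sign is $g_{i_1}+\dots+g_{i_k}$; the cycle type of $(g,\pi)$ is $\underline\lambda\in\Lambda_n(G)$ with $\underline\lambda(h)$ the partition of lengths of cycles of $\pi$ (including fixed points) of sign $h$. $C_{\underline\lambda}$ is the conjugacy class of elements of cycle type $\underline\lambda$. $C(\underline\sigma)$ is the set of $\underline\lambda\in\Lambda_n(G)$ with $C_{\underline\lambda}\cap H_{\underline\sigma}\neq\emptyset$. The inner distribution of $Y$ is $a_{\underline\lambda}=\frac{1}{|Y|}|\{(x,y)\in Y\times Y:x^{-1}y\in C_{\underline\lambda}\}|$. *)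

theory Defs
  imports "HOL-Combinatorics.Orbits" "HOL-Algebra.Sym_Groups" "HOL-Algebra.Algebra"
begin

text \<open>The finite abelian group $(G,+)$ is written multiplicatively, following HOL-Algebra:
  the identity $0$ is the unit of \<open>G\<close> and sums become products.\<close>

text \<open>A partition is the weakly decreasing list of its (positive) parts.\<close>

definition Par :: "nat list set" where
  "Par = {p. sorted_wrt (\<ge>) p \<and> 0 \<notin> set p}"

definition young_diagram :: "nat list \<Rightarrow> (nat \<times> nat) set" where
  "young_diagram p = {(r, c). r < length p \<and> c < p ! r}"


subsection \<open>The wreath product\<close>

text \<open>Elements of $G^n$ are extensional functions on \<open>{1..n}\<close>.\<close>

definition wreath :: "('a, 'm) monoid_scheme \<Rightarrow> nat \<Rightarrow> ((nat \<Rightarrow> 'a) \<times> (nat \<Rightarrow> nat)) monoid" where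
  "wreath G n =
    \<lparr> carrier = ({1..n} \<rightarrow>\<^sub>E carrier G) \<times> carrier (sym_group n),
      mult = (\<lambda>(f, \<pi>) (g, \<sigma>).
        (\<lambda>i\<in>{1..n}. f i \<otimes>\<^bsub>G\<^esub> g (inv' \<pi> i), \<pi> \<otimes>\<^bsub>sym_group n\<^esub> \<sigma>)),
      one = (\<lambda>i\<in>{1..n}. \<one>\<^bsub>G\<^esub>, \<one>\<^bsub>sym_group n\<^esub>) \<rparr>"


subsection \<open>Index sets\<close>

text \<open>Maps into partitions are made extensional, so that equality of such maps is
  equality on the intended domain.\<close>

definition Lambda_types :: "('a, 'm) monoid_scheme \<Rightarrow> nat \<Rightarrow> ('a \<Rightarrow> nat list) set" where
  "Lambda_types G n =
    {\<mu> \<in> carrier G \<rightarrow>\<^sub>E Par. (\<Sum>g\<in>carrier G. sum_list (\<mu> g)) = n}"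

definition Sigma_types :: "('a, 'm) monoid_scheme \<Rightarrow> nat \<Rightarrow> ('a set \<Rightarrow> nat list) set" where
  "Sigma_types G n =
    {\<sigma> \<in> {U. subgroup U G} \<rightarrow>\<^sub>E Par. (\<Sum>U\<in>{U. subgroup U G}. sum_list (\<sigma> U)) = n}"


subsection \<open>Tableaux and tabloids\<close>

text \<open>A box \<open>(U, r, c)\<close> is the box in row \<open>r\<close> and column \<open>c\<close> of the Young diagram belonging
  to the subgroup \<open>U\<close>.\<close>

definition boxes ::
    "('a, 'm) monoid_scheme \<Rightarrow> ('a set \<Rightarrow> nat list) \<Rightarrow> ('a set \<times> nat \<times> nat) set" where
  "boxes G \<sigma> = {(U, r, c). subgroup U G \<and> (r, c) \<in> young_diagram (\<sigma> U)}"

definition tableaux ::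
    "('a, 'm) monoid_scheme \<Rightarrow> nat \<Rightarrow> ('a set \<Rightarrow> nat list)
      \<Rightarrow> ('a set \<times> nat \<times> nat \<Rightarrow> 'a set \<times> nat) set" where
  "tableaux G n \<sigma> =
    {T \<in> (\<Pi>\<^sub>E (U, r, c)\<in>boxes G \<sigma>. (rcosets\<^bsub>G\<^esub> U) \<times> {1..n}).
      inj_on (snd \<circ> T) (boxes G \<sigma>)}"

definition row_entries ::
    "('a, 'm) monoid_scheme \<Rightarrow> ('a set \<Rightarrow> nat list)
      \<Rightarrow> ('a set \<times> nat \<times> nat \<Rightarrow> 'a set \<times> nat) \<Rightarrow> 'a set \<Rightarrow> nat \<Rightarrow> ('a set \<times> nat) set" where
  "row_entries G \<sigma> T U r = {T (U, r, c) |c. (U, r, c) \<in> boxes G \<sigma>}"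

text \<open>The entries of a tableau are distinct, so two tableaux differ by a permutation within
  the rows iff corresponding rows have the same set of entries.\<close>

definition row_equiv ::
    "('a, 'm) monoid_scheme \<Rightarrow> nat \<Rightarrow> ('a set \<Rightarrow> nat list)
      \<Rightarrow> ('a set \<times> nat \<times> nat \<Rightarrow> 'a set \<times> nat) rel" where
  "row_equiv G n \<sigma> =
    {(T, T'). T \<in> tableaux G n \<sigma> \<and> T' \<in> tableaux G n \<sigma> \<and>
      (\<forall>U r. row_entries G \<sigma> T U r = row_entries G \<sigma> T' U r)}"

definition tabloids ::
    "('a, 'm) monoid_scheme \<Rightarrow> nat \<Rightarrow> ('a set \<Rightarrow> nat list)
      \<Rightarrow> ('a set \<times> nat \<times> nat \<Rightarrow> 'a set \<times> nat) set set" where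
  "tabloids G n \<sigma> = tableaux G n \<sigma> // row_equiv G n \<sigma>"

definition act_entry ::
    "('a, 'm) monoid_scheme \<Rightarrow> (nat \<Rightarrow> 'a) \<times> (nat \<Rightarrow> nat) \<Rightarrow> 'a set \<times> nat \<Rightarrow> 'a set \<times> nat" where
  "act_entry G = (\<lambda>(g, \<pi>) (c, i). (c #>\<^bsub>G\<^esub> g (\<pi> i), \<pi> i))"

definition act_tableau ::
    "('a, 'm) monoid_scheme \<Rightarrow> ('a set \<Rightarrow> nat list) \<Rightarrow> (nat \<Rightarrow> 'a) \<times> (nat \<Rightarrow> nat)
      \<Rightarrow> ('a set \<times> nat \<times> nat \<Rightarrow> 'a set \<times> nat) \<Rightarrow> ('a set \<times> nat \<times> nat \<Rightarrow> 'a set \<times> nat)" where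
  "act_tableau G \<sigma> w T = (\<lambda>b\<in>boxes G \<sigma>. act_entry G w (T b))"

definition act_tabloid ::
    "('a, 'm) monoid_scheme \<Rightarrow> ('a set \<Rightarrow> nat list) \<Rightarrow> (nat \<Rightarrow> 'a) \<times> (nat \<Rightarrow> nat)
      \<Rightarrow> ('a set \<times> nat \<times> nat \<Rightarrow> 'a set \<times> nat) set
      \<Rightarrow> ('a set \<times> nat \<times> nat \<Rightarrow> 'a set \<times> nat) set" where
  "act_tabloid G \<sigma> w t = act_tableau G \<sigma> w ` t"

definition tabloid_stabiliser ::
    "('a, 'm) monoid_scheme \<Rightarrow> nat \<Rightarrow> ('a set \<Rightarrow> nat list)
      \<Rightarrow> ('a set \<times> nat \<times> nat \<Rightarrow> 'a set \<times> nat) set \<Rightarrow> ((nat \<Rightarrow> 'a) \<times> (nat \<Rightarrow> nat)) set" where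
  "tabloid_stabiliser G n \<sigma> t = {w \<in> carrier (wreath G n). act_tabloid G \<sigma> w t = t}"

definition is_clique ::
    "('a, 'm) monoid_scheme \<Rightarrow> nat \<Rightarrow> ('a set \<Rightarrow> nat list)
      \<Rightarrow> ((nat \<Rightarrow> 'a) \<times> (nat \<Rightarrow> nat)) set \<Rightarrow> bool" where
  "is_clique G n \<sigma> Y \<longleftrightarrow>
    Y \<noteq> {} \<and> Y \<subseteq> carrier (wreath G n) \<and>
    (\<forall>x\<in>Y. \<forall>y\<in>Y. x \<noteq> y \<longrightarrow>
      \<not> (\<exists>t\<in>tabloids G n \<sigma>.
        act_tabloid G \<sigma> (inv\<^bsub>wreath G n\<^esub> x \<otimes>\<^bsub>wreath G n\<^esub> y) t = t))"


subsection \<open>Cycle types and inner distributions\<close>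

text \<open>A cycle of a permutation, fixed points included, is represented by its support;
  since \<open>G\<close> is abelian, the sign depends only on this set.\<close>

definition cycle_supports :: "nat \<Rightarrow> (nat \<Rightarrow> nat) \<Rightarrow> nat set set" where
  "cycle_supports n \<pi> = Orbits.orbit \<pi> ` {1..n}"

definition cycle_sign :: "('a, 'm) monoid_scheme \<Rightarrow> (nat \<Rightarrow> 'a) \<Rightarrow> nat set \<Rightarrow> 'a" where
  "cycle_sign G g C = finprod G g C"

definition cycle_type ::
    "('a, 'm) monoid_scheme \<Rightarrow> nat \<Rightarrow> (nat \<Rightarrow> 'a) \<times> (nat \<Rightarrow> nat) \<Rightarrow> 'a \<Rightarrow> nat list" where
  "cycle_type G n = (\<lambda>(g, \<pi>). \<lambda>h\<in>carrier G.
    rev (sorted_list_of_multiset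
      (image_mset card (mset_set {C \<in> cycle_supports n \<pi>. cycle_sign G g C = h}))))"

definition conj_class ::
    "('a, 'm) monoid_scheme \<Rightarrow> nat \<Rightarrow> ('a \<Rightarrow> nat list) \<Rightarrow> ((nat \<Rightarrow> 'a) \<times> (nat \<Rightarrow> nat)) set" where
  "conj_class G n \<mu> = {w \<in> carrier (wreath G n). cycle_type G n w = \<mu>}"

text \<open>For \<open>H\<close> the stabiliser of a \<open>\<sigma>\<close>-tabloid, this is the set $C(\underline\sigma)$.\<close>

definition classes_meeting ::
    "('a, 'm) monoid_scheme \<Rightarrow> nat \<Rightarrow> ((nat \<Rightarrow> 'a) \<times> (nat \<Rightarrow> nat)) set \<Rightarrow> ('a \<Rightarrow> nat list) set" where
  "classes_meeting G n H = {\<mu> \<in> Lambda_types G n. conj_class G n \<mu> \<inter> H \<noteq> {}}"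

definition inner_distribution ::
    "('a, 'm) monoid_scheme \<Rightarrow> nat \<Rightarrow> ((nat \<Rightarrow> 'a) \<times> (nat \<Rightarrow> nat)) set
      \<Rightarrow> ('a \<Rightarrow> nat list) \<Rightarrow> real" where
  "inner_distribution G n Y \<mu> =
    real (card {(x, y) \<in> Y \<times> Y. inv\<^bsub>wreath G n\<^esub> x \<otimes>\<^bsub>wreath G n\<^esub> y \<in> conj_class G n \<mu>})
      / real (card Y)"

end

(* The wreath product acts transitively on tabloids, so the stabilisers of any two tabloids are
   conjugate. Two elements of the wreath product are conjugate iff they have the same cycle type:
   a sign- and length-preserving bijection between their cycles determines the permutation part of
   a conjugating element, and its base part is a potential along each cycle, which exists because
   the two signs agree. Hence an element fixes some tabloid iff its cycle type is that of an
   element fixing the given one, and the identity is the only element whose cycles are n fixed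
   points of trivial sign. *)
theory Submission
  imports Defs
begin

text \<open>Written additively, with k = h \<circ> s and d(i) = g'(s(i)) - g(i), the equation saying
  that (h, s) conjugates (g, p) to (g', p') becomes k(p(i)) - k(i) = d(p(i)), once s intertwines p
  and p'. On each cycle this is a difference equation with a periodic boundary condition; it is
  solvable exactly when d sums to zero over the cycle, which is the equality of the two signs. The
  obstacle is one of representation: a cycle is only a support, without a starting point, and a
  cycle type only keeps sorted lists of lengths. So equality of types has to be converted into an
  actual bijection of supports, and a base point is chosen in every cycle and in its partner. Both
  permutations are then described by the same coordinates (cycle, number of steps from the base
  point), in which each of them adds one step and wraps around at the common length.\<close>

section \<open>Cycles of a permutation\<close>

lemma count_image_mset_set:
  assumes "finite A"
  shows "count (image_mset f (mset_set A)) v = card {a\<in>A. f a = v}"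
proof -
  have "count (image_mset f (mset_set A)) v = (\<Sum>a | a \<in> A \<and> v = f a. 1)"
    using assms by (auto simp: count_image_mset' intro!: sum.cong)
  then show ?thesis by (simp add: eq_commute)
qed

text \<open>Equal multiplicities mean that the fibres of \<open>f\<close> and \<open>g\<close> over
  each value have the same size. Bijections between corresponding fibres glue to one bijection,
  since fibres over different values are disjoint. This is the source of the matching between the
  cycles of two elements of equal cycle type.\<close>

lemma image_mset_eq_iff_bij_betw:
  assumes "finite A" "finite B"
  shows "image_mset f (mset_set A) = image_mset g (mset_set B) \<longleftrightarrow>
    (\<exists>\<phi>. bij_betw \<phi> A B \<and> (\<forall>a\<in>A. g (\<phi> a) = f a))"
proof
  assume eq: "image_mset f (mset_set A) = image_mset g (mset_set B)"
  have "card {a\<in>A. f a = v} = card {b\<in>B. g b = v}" for v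
  proof -
    have "count (image_mset f (mset_set A)) v = count (image_mset g (mset_set B)) v"
      using eq by simp
    then show ?thesis
      using assms by (simp add: count_image_mset_set)
  qed
  then have "\<forall>v. \<exists>\<phi>. bij_betw \<phi> {a\<in>A. f a = v} {b\<in>B. g b = v}"
    using assms by (auto intro!: finite_same_card_bij)
  then obtain \<phi> where \<phi>: "\<And>v. bij_betw (\<phi> v) {a\<in>A. f a = v} {b\<in>B. g b = v}"
    by metis
  have im: "\<phi> (f a) a \<in> B \<and> g (\<phi> (f a) a) = f a" if "a \<in> A" for a
    using bij_betwE[OF \<phi>[of "f a"]] that by auto
  have "bij_betw (\<lambda>a. \<phi> (f a) a) A B"
    unfolding bij_betw_def
  proof
    show "inj_on (\<lambda>a. \<phi> (f a) a) A"
    proof (rule inj_onI)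
      fix a a' assume a: "a \<in> A" "a' \<in> A" "\<phi> (f a) a = \<phi> (f a') a'"
      then have "f a = f a'" using im by metis
      with a show "a = a'"
        using bij_betw_imp_inj_on[OF \<phi>[of "f a"]] by (auto simp: inj_on_def)
    qed
    show "(\<lambda>a. \<phi> (f a) a) ` A = B"
    proof
      show "B \<subseteq> (\<lambda>a. \<phi> (f a) a) ` A"
      proof
        fix b assume "b \<in> B"
        then have "b \<in> \<phi> (g b) ` {a\<in>A. f a = g b}"
          using bij_betw_imp_surj_on[OF \<phi>[of "g b"]] by auto
        then show "b \<in> (\<lambda>a. \<phi> (f a) a) ` A" by force
      qed
    qed (use im in auto)
  qed
  then show "\<exists>\<phi>. bij_betw \<phi> A B \<and> (\<forall>a\<in>A. g (\<phi> a) = f a)"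
    using im by blast
next
  assume "\<exists>\<phi>. bij_betw \<phi> A B \<and> (\<forall>a\<in>A. g (\<phi> a) = f a)"
  then obtain \<phi> where \<phi>: "bij_betw \<phi> A B" "\<And>a. a \<in> A \<Longrightarrow> g (\<phi> a) = f a"
    by blast
  have "mset_set B = image_mset \<phi> (mset_set A)"
    using \<phi>(1) by (metis bij_betw_def image_mset_mset_set)
  then show "image_mset f (mset_set A) = image_mset g (mset_set B)"
    using \<phi>(2) assms by (auto simp: multiset.map_comp intro!: image_mset_cong)
qed

section \<open>Cycle supports as a partition of \<open>{1..n}\<close>\<close>

lemma orbit_eq_of_mem:
  assumes "permutation p" "y \<in> Orbits.orbit p x"
  shows "Orbits.orbit p y = Orbits.orbit p x"
  using assms by (meson orbit_swap orbit_trans permutation_self_in_orbit subsetI subset_antisym)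

lemma permutes_permutation: "p permutes {1..n::nat} \<Longrightarrow> permutation p"
  using permutation_permutes by blast

lemma cycle_supports_eqD:
  assumes "p permutes {1..n}" "C \<in> cycle_supports n p" "i \<in> C"
  shows "Orbits.orbit p i = C"
  using assms orbit_eq_of_mem[OF permutes_permutation] by (auto simp: cycle_supports_def)

lemma cycle_supports_subset:
  assumes "p permutes {1..n}" "C \<in> cycle_supports n p"
  shows "C \<subseteq> {1..n}"
  using assms permutes_orbit_subset by (fastforce simp: cycle_supports_def)

lemma Union_cycle_supports:
  assumes "p permutes {1..n}"
  shows "\<Union>(cycle_supports n p) = {1..n}"
proof
  show "{1..n} \<subseteq> \<Union>(cycle_supports n p)"
    using permutation_self_in_orbit[OF permutes_permutation[OF assms]]
    by (auto simp: cycle_supports_def)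
qed (use cycle_supports_subset[OF assms] in auto)

lemma cycle_supports_disjoint:
  assumes "p permutes {1..n}" "C \<in> cycle_supports n p" "D \<in> cycle_supports n p" "C \<noteq> D"
  shows "C \<inter> D = {}"
  using assms cycle_supports_eqD by blast

lemma finite_cycle_supports: "finite (cycle_supports n p)"
  by (simp add: cycle_supports_def)

lemma image_cycle_support:
  assumes "p permutes {1..n}" "C \<in> cycle_supports n p"
  shows "p ` C = C"
proof -
  obtain i where i: "C = Orbits.orbit p i"
    using assms by (auto simp: cycle_supports_def)
  have "finite C" using cycle_supports_subset[OF assms] finite_subset by blast
  moreover have "p ` C \<subseteq> C" using i by (auto intro: orbit.step)
  moreover have "inj_on p C" using assms(1) permutes_inj_on by blast
  ultimately show ?thesis by (simp add: endo_inj_surj)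
qed

lemma sum_card_cycle_supports:
  assumes "p permutes {1..n}"
  shows "(\<Sum>C\<in>cycle_supports n p. card C) = n"
proof -
  have "card (\<Union>(cycle_supports n p)) = (\<Sum>C\<in>cycle_supports n p. card C)"
    using cycle_supports_disjoint[OF assms] finite_subset[OF cycle_supports_subset[OF assms]]
    by (intro card_Union_disjoint) (auto simp: pairwise_def disjnt_def)
  then show ?thesis using Union_cycle_supports[OF assms] by simp
qed

text \<open>\<open>funpow_dist1 p b b\<close> is the first return time of \<open>b\<close>. The
  powers of \<open>p\<close> below it enumerate the orbit without repetition, so it equals the
  length of the cycle; the second claim is the wrap-around used whenever a cycle is followed past
  its last point.\<close>

lemma cycle_support_parametrised:
  assumes p: "p permutes {1..n}" and C: "C \<in> cycle_supports n p" and b: "b \<in> C"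
  shows "bij_betw (\<lambda>k. (p ^^ k) b) {..<card C} C" and "(p ^^ card C) b = b"
proof -
  have C_eq: "C = Orbits.orbit p b" using cycle_supports_eqD[OF p C b] by simp
  have self: "b \<in> Orbits.orbit p b" using C_eq b by simp
  let ?d = "funpow_dist1 p b b"
  have bij: "bij_betw (\<lambda>k. (p ^^ k) b) {..<?d} C"
    using inj_on_funpow_dist1[OF self] orbit_conv_funpow_dist1[OF self] C_eq
    by (simp add: bij_betw_def lessThan_atLeast0)
  have "card C = ?d" using bij_betw_same_card[OF bij] by simp
  then show "bij_betw (\<lambda>k. (p ^^ k) b) {..<card C} C" "(p ^^ card C) b = b"
    using bij funpow_dist1_prop[OF self] by simp_all
qed

text \<open>The index set \<open>I\<close> is arbitrary so that matching cycles of two permutations can share coordinates.\<close>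

lemma cycle_coordinates:
  assumes p: "p permutes {1..n}" and \<phi>: "bij_betw \<phi> I (cycle_supports n p)"
    and b: "\<And>C. C \<in> I \<Longrightarrow> b C \<in> \<phi> C" and l: "\<And>C. C \<in> I \<Longrightarrow> l C = card (\<phi> C)"
  shows "bij_betw (\<lambda>(C, k). (p ^^ k) (b C)) (SIGMA C:I. {..<l C}) {1..n}"
proof -
  have bij: "bij_betw (\<lambda>k. (p ^^ k) (b C)) {..<l C} (\<phi> C)" if "C \<in> I" for C
    using cycle_support_parametrised(1)[OF p _ b[OF that]] that bij_betwE[OF \<phi>] l by auto
  have mem: "(p ^^ k) (b C) \<in> \<phi> C" if "C \<in> I" "k < l C" for C k
    using bij_betwE[OF bij[OF that(1)]] that by auto
  show ?thesis unfolding bij_betw_def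
  proof
    show "inj_on (\<lambda>(C, k). (p ^^ k) (b C)) (SIGMA C:I. {..<l C})"
    proof (rule inj_onI, clarsimp)
      fix C k D m
      assume *: "C \<in> I" "k < l C" "D \<in> I" "m < l D" "(p ^^ k) (b C) = (p ^^ m) (b D)"
      have "\<phi> C = \<phi> D"
        using * mem[of C k] mem[of D m] cycle_supports_disjoint[OF p] bij_betwE[OF \<phi>]
        by fastforce
      then have "C = D" using * bij_betw_imp_inj_on[OF \<phi>] by (auto simp: inj_on_def)
      with * show "C = D \<and> k = m"
        using bij_betw_imp_inj_on[OF bij[of C]] by (auto simp: inj_on_def)
    qed
    have "(\<lambda>(C, k). (p ^^ k) (b C)) ` (SIGMA C:I. {..<l C})
        = (\<Union>C\<in>I. (\<lambda>k. (p ^^ k) (b C)) ` {..<l C})" by auto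
    also have "\<dots> = (\<Union>C\<in>I. \<phi> C)"
      using bij_betw_imp_surj_on[OF bij] by simp
    also have "\<dots> = {1..n}"
      using bij_betw_imp_surj_on[OF \<phi>] Union_cycle_supports[OF p] by simp
    finally show "(\<lambda>(C, k). (p ^^ k) (b C)) ` (SIGMA C:I. {..<l C}) = {1..n}" .
  qed
qed

section \<open>Conjugacy in the wreath product\<close>

text \<open>The index set \<open>{1..n}\<close> has to survive simplification as one term: facts on
  permutations and on \<open>PiE\<close> speak of membership in it, not of the pair of inequalities
  it unfolds to.\<close>

declare One_nat_def [simp del] and atLeastAtMost_iff [simp del]

lemma mem_wreath_iff:
  "(g, p) \<in> carrier (wreath G n) \<longleftrightarrow> g \<in> {1..n} \<rightarrow>\<^sub>E carrier G \<and> p permutes {1..n}"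
  by (simp add: wreath_def sym_group_def)

lemma mult_wreath:
  "(f, p) \<otimes>\<^bsub>wreath G n\<^esub> (g, q) = (\<lambda>i\<in>{1..n}. f i \<otimes>\<^bsub>G\<^esub> g (inv' p i), p \<circ> q)"
  by (simp add: wreath_def sym_group_def)

lemma one_wreath: "\<one>\<^bsub>wreath G n\<^esub> = (\<lambda>i\<in>{1..n}. \<one>\<^bsub>G\<^esub>, id)"
  by (simp add: wreath_def sym_group_def)

lemma finite_wreath:
  assumes "finite (carrier G)"
  shows "finite (carrier (wreath G n))"
  using assms by (simp add: wreath_def sym_group_def finite_PiE finite_permutations)

lemma wreath_memD:
  assumes "(g, p) \<in> carrier (wreath G n)"
  shows "p permutes {1..n}" and "i \<in> {1..n} \<Longrightarrow> g i \<in> carrier G"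
  using assms by (auto simp only: mem_wreath_iff PiE_mem)

lemma restrict_eq_iff: "restrict f A = restrict g A \<longleftrightarrow> (\<forall>x\<in>A. f x = g x)"
  by (metis restrict_apply' restrict_ext)

lemma sorted_list_of_multiset_inject:
  "sorted_list_of_multiset M = sorted_list_of_multiset N \<longleftrightarrow> M = N"
  by (metis mset_sorted_list_of_multiset)

lemma permutes_inv_mem_iff: "p permutes S \<Longrightarrow> inv' p i \<in> S \<longleftrightarrow> i \<in> S"
  by (simp add: permutes_in_image permutes_inv)

context comm_group
begin

lemma wreath_group: "group (wreath G n)"
proof (rule groupI)
  fix x y assume "x \<in> carrier (wreath G n)" "y \<in> carrier (wreath G n)"
  moreover obtain f p g q where "x = (f, p)" "y = (g, q)" by (metis surj_pair)
  ultimately show "x \<otimes>\<^bsub>wreath G n\<^esub> y \<in> carrier (wreath G n)"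
    using wreath_memD[of f p G n] wreath_memD[of g q G n]
    by (auto simp: mem_wreath_iff mult_wreath permutes_compose permutes_inv_mem_iff)
next
  show "\<one>\<^bsub>wreath G n\<^esub> \<in> carrier (wreath G n)"
    by (auto simp: mem_wreath_iff one_wreath permutes_id)
next
  fix x y z
  assume xyz: "x \<in> carrier (wreath G n)" "y \<in> carrier (wreath G n)" "z \<in> carrier (wreath G n)"
  obtain f p g q h r where eqs: "x = (f, p)" "y = (g, q)" "z = (h, r)"
    by (metis surj_pair)
  have perm: "p permutes {1..n}" "q permutes {1..n}"
    and f: "f \<in> {1..n} \<rightarrow>\<^sub>E carrier G" "g \<in> {1..n} \<rightarrow>\<^sub>E carrier G" "h \<in> {1..n} \<rightarrow>\<^sub>E carrier G"
    using xyz by (auto simp: eqs mem_wreath_iff)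
  have [simp]: "inv' (p \<circ> q) = inv' q \<circ> inv' p"
    using perm by (meson o_inv_distrib permutes_bij)
  show "x \<otimes>\<^bsub>wreath G n\<^esub> y \<otimes>\<^bsub>wreath G n\<^esub> z = x \<otimes>\<^bsub>wreath G n\<^esub> (y \<otimes>\<^bsub>wreath G n\<^esub> z)"
    using PiE_mem[OF f(1)] PiE_mem[OF f(2)] PiE_mem[OF f(3)] perm
    by (auto simp: eqs mult_wreath comp_assoc restrict_eq_iff m_assoc permutes_inv_mem_iff)
next
  fix x assume x: "x \<in> carrier (wreath G n)"
  obtain g p where gp: "x = (g, p)" by force
  then have p: "p permutes {1..n}" and g: "g \<in> {1..n} \<rightarrow>\<^sub>E carrier G"
    using x by (auto simp: mem_wreath_iff)
  show "\<one>\<^bsub>wreath G n\<^esub> \<otimes>\<^bsub>wreath G n\<^esub> x = x"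
  proof -
    have "(if i \<in> {1..n} then (if i \<in> {1..n} then \<one> else undefined) \<otimes> g i else undefined) = g i" for i
      using PiE_mem[OF g] PiE_arb[OF g] by (cases "i \<in> {1..n}") (simp_all)
    then show ?thesis by (simp add: gp one_wreath mult_wreath restrict_def inv_id)
  qed
  \<comment> \<open>A left factor with permutation \<open>inv' p\<close> reads the base part of
    \<open>x\<close> at \<open>inv' (inv' p) i\<close>, that is at \<open>p i\<close>, so this is
    the entry to be cancelled.\<close>
  have "(\<lambda>i\<in>{1..n}. inv (g (p i)), inv' p) \<in> carrier (wreath G n)"
    using p g by (auto simp: mem_wreath_iff permutes_inv permutes_in_image PiE_mem)
  moreover have "(\<lambda>i\<in>{1..n}. inv (g (p i)), inv' p) \<otimes>\<^bsub>wreath G n\<^esub> x = \<one>\<^bsub>wreath G n\<^esub>"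
    using p PiE_mem[OF g] by (simp add: gp mult_wreath one_wreath permutes_inv_o restrict_eq_iff
        permutes_inv_inv permutes_in_image)
  ultimately show "\<exists>y\<in>carrier (wreath G n). y \<otimes>\<^bsub>wreath G n\<^esub> x = \<one>\<^bsub>wreath G n\<^esub>" by blast
qed

text \<open>Since \<open>s \<circ> p\<close> permutes \<open>{1..n}\<close>, the coordinates may be
  indexed by \<open>s (p i)\<close>. This removes all inverse permutations and leaves a relation
  between the values of \<open>h \<circ> s\<close> at \<open>i\<close> and at its successor
  \<open>p i\<close>, the form used in both directions of the conjugacy criterion.\<close>

lemma wreath_mult_eq_iff:
  assumes "(g, p) \<in> carrier (wreath G n)" "(g', p') \<in> carrier (wreath G n)"
    and "(h, s) \<in> carrier (wreath G n)" and comm: "s \<circ> p = p' \<circ> s"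
  shows "(h, s) \<otimes>\<^bsub>wreath G n\<^esub> (g, p) = (g', p') \<otimes>\<^bsub>wreath G n\<^esub> (h, s) \<longleftrightarrow>
    (\<forall>i\<in>{1..n}. h (s (p i)) \<otimes> g (p i) = g' (s (p i)) \<otimes> h (s i))"
proof -
  have p: "p permutes {1..n}" and p': "p' permutes {1..n}" and s: "s permutes {1..n}"
    using assms by (auto simp: mem_wreath_iff)
  have "(h, s) \<otimes>\<^bsub>wreath G n\<^esub> (g, p) = (g', p') \<otimes>\<^bsub>wreath G n\<^esub> (h, s) \<longleftrightarrow>
      (\<forall>i\<in>{1..n}. h i \<otimes> g (inv' s i) = g' i \<otimes> h (inv' p' i))"
    using comm by (auto simp: mult_wreath fun_eq_iff restrict_def)
  also have "\<dots> \<longleftrightarrow> (\<forall>i\<in>(s \<circ> p) ` {1..n}. h i \<otimes> g (inv' s i) = g' i \<otimes> h (inv' p' i))"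
    using permutes_image[OF permutes_compose[OF p s]] by simp
  also have "\<dots> \<longleftrightarrow> (\<forall>i\<in>{1..n}. h (s (p i)) \<otimes> g (p i) = g' (s (p i)) \<otimes> h (s i))"
  proof -
    have "inv' p' (s (p i)) = s i" for i
      using comm p' by (metis comp_apply permutes_inverses(2))
    then show ?thesis
      using s by (simp add: permutes_inverses)
  qed
  finally show ?thesis .
qed

lemma wreath_mult_eq_imp_comm:
  assumes "(h, s) \<otimes>\<^bsub>wreath G n\<^esub> (g, p) = (g', p') \<otimes>\<^bsub>wreath G n\<^esub> (h, s)"
  shows "s \<circ> p = p' \<circ> s"
  using assms by (simp add: mult_wreath)

section \<open>Cycle type as a complete conjugacy invariant\<close>

text \<open>Sorting loses nothing but the order, so a cycle type amounts to one multiset of lengths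
  for each sign. Together these are a single multiset of pairs (sign, length) indexed by the cycles,
  and equality of two such multisets is a matching of the cycles.\<close>

lemma cycle_type_eq_iff:
  assumes w: "(g, p) \<in> carrier (wreath G n)" and w': "(g', p') \<in> carrier (wreath G n)"
  shows "cycle_type G n (g, p) = cycle_type G n (g', p') \<longleftrightarrow>
    (\<exists>\<phi>. bij_betw \<phi> (cycle_supports n p) (cycle_supports n p') \<and>
      (\<forall>C\<in>cycle_supports n p. card (\<phi> C) = card C \<and> cycle_sign G g' (\<phi> C) = cycle_sign G g C))"
    (is "?L \<longleftrightarrow> ?R")
proof -
  let ?f = "\<lambda>C. (cycle_sign G g C, card C)" and ?f' = "\<lambda>C. (cycle_sign G g' C, card C)"
  have sign: "cycle_sign G g C \<in> carrier G"
    if "(g, p) \<in> carrier (wreath G n)" "C \<in> cycle_supports n p" for g p C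
    using wreath_memD[OF that(1)] cycle_supports_subset[OF wreath_memD(1)[OF that(1)] that(2)]
    unfolding cycle_sign_def by (intro finprod_closed) blast
  have count: "count (image_mset (\<lambda>C. (cycle_sign G g C, card C)) (mset_set (cycle_supports n p))) (h, m) =
      count (image_mset card (mset_set {C \<in> cycle_supports n p. cycle_sign G g C = h})) m"
    for g p h m
    using finite_cycle_supports[of n p]
    by (simp add: count_image_mset_set conj_assoc)
  have "?L \<longleftrightarrow> (\<forall>h\<in>carrier G.
      image_mset card (mset_set {C \<in> cycle_supports n p. cycle_sign G g C = h}) =
      image_mset card (mset_set {C \<in> cycle_supports n p'. cycle_sign G g' C = h}))"
    unfolding cycle_type_def by (simp add: restrict_eq_iff sorted_list_of_multiset_inject)
  \<comment> \<open>Signs lie in the carrier, so for any other \<open>h\<close> both multisets are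
    empty. Dropping the bound on \<open>h\<close> lets the counts at all pairs be compared at
    once.\<close>
  also have "\<dots> \<longleftrightarrow> (\<forall>h.
      image_mset card (mset_set {C \<in> cycle_supports n p. cycle_sign G g C = h}) =
      image_mset card (mset_set {C \<in> cycle_supports n p'. cycle_sign G g' C = h}))"
  proof -
    have "{C \<in> cycle_supports n p. cycle_sign G g C = h} =
        {C \<in> cycle_supports n p'. cycle_sign G g' C = h} \<and>
        {C \<in> cycle_supports n p'. cycle_sign G g' C = h} = {}" if "h \<notin> carrier G" for h
      using that sign[OF w] sign[OF w'] by auto
    then have "image_mset card (mset_set {C \<in> cycle_supports n p. cycle_sign G g C = h}) =
        image_mset card (mset_set {C \<in> cycle_supports n p'. cycle_sign G g' C = h})"
      if "h \<notin> carrier G" for h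
      using that by simp
    then show ?thesis by blast
  qed
  also have "\<dots> \<longleftrightarrow> image_mset ?f (mset_set (cycle_supports n p)) =
      image_mset ?f' (mset_set (cycle_supports n p'))"
    unfolding multiset_eq_iff[of "image_mset ?f _"] split_paired_All count
    unfolding multiset_eq_iff ..
  also have "\<dots> \<longleftrightarrow> ?R"
    by (subst image_mset_eq_iff_bij_betw) (auto simp: finite_cycle_supports)
  finally show ?thesis .
qed

lemma conjugate_imp_cycle_type_eq:
  assumes w: "(g, p) \<in> carrier (wreath G n)" and w': "(g', p') \<in> carrier (wreath G n)"
    and u: "(h, s) \<in> carrier (wreath G n)"
    and conj: "(h, s) \<otimes>\<^bsub>wreath G n\<^esub> (g, p) = (g', p') \<otimes>\<^bsub>wreath G n\<^esub> (h, s)"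
  shows "cycle_type G n (g, p) = cycle_type G n (g', p')"
proof -
  have p: "p permutes {1..n}" and p': "p' permutes {1..n}" and s: "s permutes {1..n}"
    and g: "\<And>i. i \<in> {1..n} \<Longrightarrow> g i \<in> carrier G" and g': "\<And>i. i \<in> {1..n} \<Longrightarrow> g' i \<in> carrier G"
    and h: "\<And>i. i \<in> {1..n} \<Longrightarrow> h i \<in> carrier G"
    using wreath_memD[OF w] wreath_memD[OF w'] wreath_memD[OF u] by blast+
  have comm: "s \<circ> p = p' \<circ> s" using wreath_mult_eq_imp_comm[OF conj] .
  have rel: "h (s (p i)) \<otimes> g (p i) = g' (s (p i)) \<otimes> h (s i)" if "i \<in> {1..n}" for i
    using wreath_mult_eq_iff[OF w w' u comm] conj that by simp
  have inj: "inj_on s A" for A using s permutes_inj_on by blast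
  have pow: "s ((p ^^ k) i) = (p' ^^ k) (s i)" for k i
    by (induction k) (use comm in \<open>auto simp: fun_eq_iff\<close>)
  then have orbit: "Orbits.orbit p' (s i) = s ` Orbits.orbit p i" for i
    by (auto simp: orbit_altdef simp flip: pow)
  have "cycle_supports n p' = Orbits.orbit p' ` s ` {1..n}"
    using permutes_image[OF s] by (simp add: cycle_supports_def)
  also have "\<dots> = (`) s ` cycle_supports n p"
    by (simp add: cycle_supports_def image_image orbit)
  finally have "bij_betw ((`) s) (cycle_supports n p) (cycle_supports n p')"
    unfolding bij_betw_def using permutes_inj[OF s] by (auto simp: inj_on_def inj_image_eq_iff)
  moreover have "card (s ` C) = card C" for C
    by (rule card_image[OF inj])
  moreover have "cycle_sign G g' (s ` C) = cycle_sign G g C" if C: "C \<in> cycle_supports n p" for C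
  proof -
    have sub: "i \<in> {1..n}" if "i \<in> C" for i
      using cycle_supports_subset[OF p C] that by blast
    have pC: "p ` C = C" "inj_on p C"
      using image_cycle_support[OF p C] permutes_inj_on[OF p] by auto
    have p_mem: "p i \<in> {1..n}" if "i \<in> C" for i
      using pC sub that by blast
    have s_mem: "s i \<in> {1..n}" if "i \<in> {1..n}" for i
      using that permutes_in_image[OF s] by blast
    note mem = p_mem s_mem sub g g' h
    \<comment> \<open>Going one step along the cycle leaves a product over the whole cycle
      unchanged; this makes the contributions of \<open>h\<close> cancel.\<close>
    have shift: "finprod G (\<lambda>i. f (p i)) C = finprod G f C" if "f \<in> C \<rightarrow> carrier G" for f
      using finprod_reindex[of f p C] pC that by simp
    have "finprod G (\<lambda>i. h (s i)) C \<otimes> finprod G g C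
        = finprod G (\<lambda>i. h (s (p i))) C \<otimes> finprod G (\<lambda>i. g (p i)) C"
      using shift[of "\<lambda>i. h (s i)"] shift[of g] by (simp add: Pi_def mem)
    also have "\<dots> = finprod G (\<lambda>i. h (s (p i)) \<otimes> g (p i)) C"
      by (subst finprod_multf) (auto simp: mem)
    also have "\<dots> = finprod G (\<lambda>i. g' (s (p i)) \<otimes> h (s i)) C"
      by (rule finprod_cong) (auto simp: mem rel)
    also have "\<dots> = finprod G (\<lambda>i. g' (s i)) C \<otimes> finprod G (\<lambda>i. h (s i)) C"
      by (subst finprod_multf, simp_all add: Pi_def mem)
        (subst shift, simp_all add: Pi_def mem)
    also have "\<dots> = finprod G (\<lambda>i. h (s i)) C \<otimes> finprod G (\<lambda>i. g' (s i)) C"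
      by (rule m_comm) (auto intro!: finprod_closed simp: mem)
    finally have "finprod G g C = finprod G (\<lambda>i. g' (s i)) C"
      by (rule l_cancel)
        (auto intro!: finprod_closed simp: mem)
    then show ?thesis
      unfolding cycle_sign_def
      by (subst finprod_reindex) (auto simp: mem inj)
  qed
  ultimately show ?thesis
    unfolding cycle_type_eq_iff[OF w w'] by blast
qed

text \<open>Partial products of \<open>d\<close> along a cycle satisfy the recursion at every step
  except possibly the one that closes the cycle. There the requirement is that the product of
  \<open>d\<close> over the whole cycle be trivial.\<close>

lemma cyclic_potential:
  assumes p: "p permutes {1..n}" and d: "\<And>i. i \<in> {1..n} \<Longrightarrow> d i \<in> carrier G"
    and prod: "\<And>C. C \<in> cycle_supports n p \<Longrightarrow> finprod G d C = \<one>"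
  obtains k where "\<And>i. i \<in> {1..n} \<Longrightarrow> k i \<in> carrier G"
    and "\<And>i. i \<in> {1..n} \<Longrightarrow> k (p i) = k i \<otimes> d (p i)"
proof -
  have "\<forall>C\<in>cycle_supports n p. \<exists>x. x \<in> C"
    using orbit_nonempty by (force simp: cycle_supports_def)
  then obtain b where b: "\<And>C. C \<in> cycle_supports n p \<Longrightarrow> b C \<in> C" by metis
  define I where "I = (SIGMA C:cycle_supports n p. {..<card C})"
  define F where "F = (\<lambda>(C, m). (p ^^ m) (b C))"
  have F: "bij_betw F I {1..n}"
    unfolding F_def I_def using cycle_coordinates[OF p bij_betw_id, of b card] b by simp
  have d_mem: "d (F (C, l)) \<in> carrier G" if "C \<in> cycle_supports n p" "l < card C" for C l
    using that d bij_betwE[OF F] by (auto simp: I_def)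
  \<comment> \<open>The factor at \<open>l = 0\<close> is included, so the base point gets its own
    value of \<open>d\<close> and the last point gets the full product. With that product trivial,
    the closing step also obeys the recursion.\<close>
  define K where "K = (\<lambda>(C, m). finprod G (\<lambda>l. d (F (C, l))) {..m})"
  define k where "k = (\<lambda>i. K (inv_into I F i))"
  have k_F: "k (F x) = K x" if "x \<in> I" for x
    using bij_betw_inv_into_left[OF F that] by (simp add: k_def)
  have K_mem: "K x \<in> carrier G" if "x \<in> I" for x
    using that unfolding K_def I_def by (auto intro!: finprod_closed d_mem)
  have "k i \<in> carrier G \<and> k (p i) = k i \<otimes> d (p i)" if i: "i \<in> {1..n}" for i
  proof -
    obtain C m where Cm: "(C, m) \<in> I" "i = F (C, m)"
      using i bij_betw_imp_surj_on[OF F] by (metis imageE surj_pair)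
    then have C: "C \<in> cycle_supports n p" and m: "m < card C" by (auto simp: I_def)
    note par = cycle_support_parametrised[OF p C b[OF C]]
    have p_i: "p i = (p ^^ Suc m) (b C)" using Cm by (simp add: F_def)
    show ?thesis
    proof (cases "Suc m < card C")
      case True
      then have mem: "(C, Suc m) \<in> I" using C by (simp add: I_def)
      moreover have "p i = F (C, Suc m)" using p_i by (simp add: F_def)
      moreover have "K (C, Suc m) = K (C, m) \<otimes> d (F (C, Suc m))"
        unfolding K_def using True C d_mem by (auto simp: finprod_Suc m_comm)
      ultimately show ?thesis using Cm k_F K_mem by simp
    next
      case False
      then have card: "card C = Suc m" using m by simp
      have I0: "(C, 0) \<in> I" using C m by (simp add: I_def)
      have p_i0: "p i = F (C, 0)" using p_i par(2) card by (simp add: F_def)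
      have "K (C, m) = finprod G (\<lambda>l. d ((p ^^ l) (b C))) {..<card C}"
        by (simp add: K_def F_def card lessThan_Suc_atMost)
      also have "\<dots> = finprod G d C"
      proof -
        have "d \<in> C \<rightarrow> carrier G" using d cycle_supports_subset[OF p C] by blast
        then show ?thesis
          using finprod_reindex[of d "\<lambda>l. (p ^^ l) (b C)" "{..<card C}"] par(1)
          by (simp add: bij_betw_def)
      qed
      also have "\<dots> = \<one>" using prod C .
      finally have "k i = \<one>" using k_F Cm by simp
      moreover have "k (p i) = d (p i)"
        using k_F[OF I0] d_mem[OF C, of 0] m p_i0 by (auto simp: K_def)
      ultimately show ?thesis using d_mem[OF C, of 0] m p_i0 by auto
    qed
  qed
  then show ?thesis using that by blast
qed

lemma cycle_type_eq_imp_conjugate: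
  assumes w: "(g, p) \<in> carrier (wreath G n)" and w': "(g', p') \<in> carrier (wreath G n)"
    and type: "cycle_type G n (g, p) = cycle_type G n (g', p')"
  obtains u where "u \<in> carrier (wreath G n)"
    and "u \<otimes>\<^bsub>wreath G n\<^esub> (g, p) = (g', p') \<otimes>\<^bsub>wreath G n\<^esub> u"
proof -
  note p = wreath_memD(1)[OF w] and p' = wreath_memD(1)[OF w']
    and g = wreath_memD(2)[OF w] and g' = wreath_memD(2)[OF w']
  obtain \<phi> where \<phi>: "bij_betw \<phi> (cycle_supports n p) (cycle_supports n p')"
    and card: "\<And>C. C \<in> cycle_supports n p \<Longrightarrow> card (\<phi> C) = card C"
    and sign: "\<And>C. C \<in> cycle_supports n p \<Longrightarrow> cycle_sign G g' (\<phi> C) = cycle_sign G g C"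
    using type unfolding cycle_type_eq_iff[OF w w'] by blast
  have \<phi>_mem: "\<phi> C \<in> cycle_supports n p'" if "C \<in> cycle_supports n p" for C
    using that bij_betwE[OF \<phi>] by blast
  have ne: "\<exists>x. x \<in> C" if "C \<in> cycle_supports n q" for C q
    using that orbit_nonempty by (force simp: cycle_supports_def)
  have "\<forall>C\<in>cycle_supports n p. \<exists>x. x \<in> C" "\<forall>C\<in>cycle_supports n p. \<exists>x. x \<in> \<phi> C"
    using ne \<phi>_mem by blast+
  then obtain b b' where b: "\<And>C. C \<in> cycle_supports n p \<Longrightarrow> b C \<in> C"
    and b': "\<And>C. C \<in> cycle_supports n p \<Longrightarrow> b' C \<in> \<phi> C" by metis
  \<comment> \<open>One index set serves both permutations, because matched cycles have the same
    length.\<close>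
  define I where "I = (SIGMA C:cycle_supports n p. {..<card C})"
  define F where "F = (\<lambda>(C, m). (p ^^ m) (b C))"
  define F' where "F' = (\<lambda>(C, m). (p' ^^ m) (b' C))"
  have F: "bij_betw F I {1..n}"
    unfolding F_def I_def using cycle_coordinates[OF p bij_betw_id, of b card] b by simp
  have F': "bij_betw F' I {1..n}"
    unfolding F'_def I_def using cycle_coordinates[OF p' \<phi>, of b' card] b' card by simp
  \<comment> \<open>\<open>s\<close> sends the point \<open>m\<close> steps after \<open>b C\<close>
    to the point \<open>m\<close> steps after \<open>b' C\<close>, and is the identity outside
    \<open>{1..n}\<close> as \<open>permutes\<close> demands.\<close>
  define s where "s = (\<lambda>i. if i \<in> {1..n} then F' (inv_into I F i) else i)"
  have "bij_betw (F' \<circ> inv_into I F) {1..n} {1..n}"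
    using bij_betw_trans[OF bij_betw_inv_into[OF F] F'] .
  then have "bij_betw s {1..n} {1..n}"
    by (rule bij_betw_cong[THEN iffD1, rotated]) (simp add: s_def)
  then have s: "s permutes {1..n}"
    by (rule bij_imp_permutes) (simp add: s_def)
  have s_F: "s (F x) = F' x" if "x \<in> I" for x
    using bij_betw_inv_into_left[OF F that] bij_betwE[OF F] that by (simp add: s_def)
  have s_mem: "s i \<in> {1..n}" if "i \<in> {1..n}" for i
    using that permutes_in_image[OF s] by blast
  have p_mem: "p i \<in> {1..n}" if "i \<in> {1..n}" for i
    using that permutes_in_image[OF p] by blast
  have comm: "s \<circ> p = p' \<circ> s"
  proof
    fix i
    show "(s \<circ> p) i = (p' \<circ> s) i"
    proof (cases "i \<in> {1..n}")
      case False
      then show ?thesis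
        using permutes_not_in[OF p] permutes_not_in[OF p'] permutes_not_in[OF s] by simp
    next
      case True
      obtain C m where Cm: "(C, m) \<in> I" "i = F (C, m)"
        using True bij_betw_imp_surj_on[OF F] by (metis imageE surj_pair)
      then have C: "C \<in> cycle_supports n p" and m: "m < card C" by (auto simp: I_def)
      have p_i: "p i = (p ^^ Suc m) (b C)" and p'_i: "p' (s i) = (p' ^^ Suc m) (b' C)"
        using Cm s_F[OF Cm(1)] by (simp_all add: F_def F'_def)
      show ?thesis
      proof (cases "Suc m < card C")
        case True
        then have "(C, Suc m) \<in> I" using C by (simp add: I_def)
        from s_F[OF this] show ?thesis using p_i p'_i by (simp add: F_def F'_def)
      next
        \<comment> \<open>At the last point of \<open>C\<close> both sides return to their base
          points simultaneously, since \<open>\<phi> C\<close> is as long as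
          \<open>C\<close>.\<close>
        case False
        then have "card C = Suc m" using m by simp
        then have "p i = F (C, 0)" "p' (s i) = F' (C, 0)"
          using p_i p'_i cycle_support_parametrised(2)[OF p C b[OF C]]
            cycle_support_parametrised(2)[OF p' \<phi>_mem[OF C] b'[OF C]] card[OF C]
          by (simp_all add: F_def F'_def)
        moreover have "(C, 0) \<in> I" using C m by (simp add: I_def)
        ultimately show ?thesis using s_F by simp
      qed
    qed
  qed
  have image: "s ` C = \<phi> C" if C: "C \<in> cycle_supports n p" for C
  proof -
    have "C = (\<lambda>m. F (C, m)) ` {..<card C}"
      using bij_betw_imp_surj_on[OF cycle_support_parametrised(1)[OF p C b[OF C]]]
      by (simp add: F_def)
    then have "s ` C = (\<lambda>m. s (F (C, m))) ` {..<card C}"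
      by (metis image_image)
    also have "\<dots> = (\<lambda>m. F' (C, m)) ` {..<card C}"
      by (rule image_cong) (use s_F C in \<open>auto simp: I_def\<close>)
    also have "\<dots> = \<phi> C"
      using bij_betw_imp_surj_on[OF cycle_support_parametrised(1)[OF p' \<phi>_mem[OF C] b'[OF C]]]
      by (simp add: F'_def card[OF C])
    finally show ?thesis .
  qed
  \<comment> \<open>Solving the coordinate relation for \<open>h (s (p i))\<close> gives
    \<open>h (s i)\<close> times \<open>d (p i)\<close>. The product of \<open>d\<close> over
    \<open>C\<close> is the quotient of the signs of \<open>\<phi> C\<close> and \<open>C\<close>,
    hence trivial.\<close>
  define d where "d = (\<lambda>i. g' (s i) \<otimes> inv g i)"
  have d: "d i \<in> carrier G" if "i \<in> {1..n}" for i
    using that g g' s_mem by (simp add: d_def)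
  have "finprod G d C = \<one>" if C: "C \<in> cycle_supports n p" for C
  proof -
    have sub: "i \<in> {1..n}" if "i \<in> C" for i
      using cycle_supports_subset[OF p C] that by blast
    note mem = sub g g' s_mem d
    have "finprod G d C \<otimes> finprod G g C = finprod G (\<lambda>i. d i \<otimes> g i) C"
      by (subst finprod_multf) (auto simp: mem)
    also have "\<dots> = finprod G (\<lambda>i. g' (s i)) C"
      by (rule finprod_cong) (auto simp: d_def mem m_assoc)
    also have "\<dots> = finprod G g' (s ` C)"
      by (subst finprod_reindex) (auto simp: mem permutes_inj_on[OF s])
    also have "\<dots> = finprod G g C"
      using sign[OF C] image[OF C] by (simp add: cycle_sign_def)
    finally show ?thesis
      by (rule r_cancel_one[THEN iffD1, rotated -1]) (auto intro!: finprod_closed simp: mem)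
  qed
  then obtain k where k: "\<And>i. i \<in> {1..n} \<Longrightarrow> k i \<in> carrier G"
    "\<And>i. i \<in> {1..n} \<Longrightarrow> k (p i) = k i \<otimes> d (p i)"
    using cyclic_potential[OF p, of d] d by blast
  \<comment> \<open>The potential \<open>k\<close> plays the role of \<open>h \<circ> s\<close>, so
    it is transported back along \<open>s\<close>.\<close>
  define h where "h = (\<lambda>i\<in>{1..n}. k (inv' s i))"
  have h_s: "h (s i) = k i" if "i \<in> {1..n}" for i
    using that s_mem permutes_inverses(2)[OF s] by (simp add: h_def)
  have u: "(h, s) \<in> carrier (wreath G n)"
    using s k(1) by (auto simp: mem_wreath_iff h_def permutes_inv_mem_iff)
  moreover have "h (s (p i)) \<otimes> g (p i) = g' (s (p i)) \<otimes> h (s i)" if i: "i \<in> {1..n}" for i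
  proof -
    have "h (s (p i)) \<otimes> g (p i) = k i \<otimes> (g' (s (p i)) \<otimes> (inv g (p i) \<otimes> g (p i)))"
      using i by (simp add: h_s p_mem k d_def m_assoc g g' s_mem)
    then show ?thesis
      using i by (simp add: h_s p_mem k g g' s_mem m_comm)
  qed
  ultimately show ?thesis
    using that wreath_mult_eq_iff[OF w w' u comm] by blast
qed

end

section \<open>The action on tabloids\<close>

lemma card_young_diagram: "finite (young_diagram p)" "card (young_diagram p) = sum_list p"
proof -
  have eq: "young_diagram p = (SIGMA r:{..<length p}. {..<p ! r})"
    by (auto simp: young_diagram_def)
  show "finite (young_diagram p)" unfolding eq by auto
  show "card (young_diagram p) = sum_list p"
    unfolding eq by (simp add: sum_list_sum_nth lessThan_atLeast0)
qed

text \<open>As there are exactly \<open>n\<close> boxes and the indices in a tableau are distinct,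
  every element of \<open>{1..n}\<close> occurs in it exactly once.\<close>

lemma card_boxes:
  assumes "finite (carrier G)" "\<sigma> \<in> Sigma_types G n"
  shows "finite (boxes G \<sigma>)" "card (boxes G \<sigma>) = n"
proof -
  have eq: "boxes G \<sigma> = (SIGMA U:{U. subgroup U G}. young_diagram (\<sigma> U))"
    by (auto simp: boxes_def)
  have fin: "finite {U. subgroup U G}"
    using assms(1) by (auto intro!: finite_subset[of _ "Pow (carrier G)"] dest: subgroup.subset)
  show "finite (boxes G \<sigma>)" unfolding eq using fin card_young_diagram by blast
  show "card (boxes G \<sigma>) = n"
    unfolding eq using assms(2) fin by (simp add: card_young_diagram Sigma_types_def)
qed

context comm_group
begin

lemma tableauxD:
  assumes "T \<in> tableaux G n \<sigma>" "(U, r, c) \<in> boxes G \<sigma>"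
  obtains a i where "T (U, r, c) = (U #> a, i)" "subgroup U G" "a \<in> carrier G" "i \<in> {1..n}"
proof -
  have "T (U, r, c) \<in> (rcosets U) \<times> {1..n}"
    using assms by (auto simp: tableaux_def dest: PiE_mem)
  then obtain a i where "T (U, r, c) = (U #> a, i)" "a \<in> carrier G" "i \<in> {1..n}"
    by (auto simp: RCOSETS_def)
  then show ?thesis using that assms(2) by (auto simp: boxes_def)
qed

lemma act_tableau_closed:
  assumes T: "T \<in> tableaux G n \<sigma>" and w: "(g, p) \<in> carrier (wreath G n)"
  shows "act_tableau G \<sigma> (g, p) T \<in> tableaux G n \<sigma>"
proof -
  note p = wreath_memD(1)[OF w] and g = wreath_memD(2)[OF w]
  have "act_entry G (g, p) (T (U, r, c)) \<in> (rcosets U) \<times> {1..n}"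
    if "(U, r, c) \<in> boxes G \<sigma>" for U r c
    using T that
  proof (rule tableauxD)
    fix a i assume *: "T (U, r, c) = (U #> a, i)" "subgroup U G" "a \<in> carrier G" "i \<in> {1..n}"
    then show ?thesis
      using permutes_in_image[OF p] g subgroup.subset[OF *(2)]
      by (auto simp: act_entry_def coset_mult_assoc intro!: rcosetsI)
  qed
  moreover have "inj_on (snd \<circ> act_tableau G \<sigma> (g, p) T) (boxes G \<sigma>)"
  proof -
    have "inj_on (p \<circ> (snd \<circ> T)) (boxes G \<sigma>)"
      using T permutes_inj_on[OF p] by (auto simp: tableaux_def intro!: comp_inj_on)
    moreover have "snd (act_tableau G \<sigma> (g, p) T b) = p (snd (T b))" if "b \<in> boxes G \<sigma>" for b
      using that by (simp add: act_tableau_def act_entry_def case_prod_unfold)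
    ultimately show ?thesis by (simp add: inj_on_def)
  qed
  ultimately show ?thesis
    by (auto simp: tableaux_def act_tableau_def)
qed

text \<open>Acting twice translates a coset by the entry of \<open>g\<close> and afterwards by that
  of \<open>f\<close>, while the base part of the product has these factors in the opposite order.
  They agree because \<open>G\<close> is commutative.\<close>

lemma act_tableau_mult:
  assumes T: "T \<in> tableaux G n \<sigma>" and v: "(f, q) \<in> carrier (wreath G n)"
    and w: "(g, p) \<in> carrier (wreath G n)"
  shows "act_tableau G \<sigma> (f, q) (act_tableau G \<sigma> (g, p) T)
    = act_tableau G \<sigma> ((f, q) \<otimes>\<^bsub>wreath G n\<^esub> (g, p)) T"
proof -
  note p = wreath_memD(1)[OF w] and g = wreath_memD(2)[OF w]
    and q = wreath_memD(1)[OF v] and f = wreath_memD(2)[OF v]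
  have "act_entry G (f, q) (act_entry G (g, p) (T (U, r, c)))
      = act_entry G ((f, q) \<otimes>\<^bsub>wreath G n\<^esub> (g, p)) (T (U, r, c))"
    if "(U, r, c) \<in> boxes G \<sigma>" for U r c
    using T that
  proof (rule tableauxD)
    fix a i assume *: "T (U, r, c) = (U #> a, i)" "subgroup U G" "a \<in> carrier G" "i \<in> {1..n}"
    moreover have "p i \<in> {1..n}" "q (p i) \<in> {1..n}"
      using * permutes_in_image[OF p] permutes_in_image[OF q] by auto
    ultimately show ?thesis
      using f g permutes_inverses(2)[OF q]
      by (simp add: act_entry_def mult_wreath coset_mult_assoc subgroup.subset m_ac)
  qed
  then show ?thesis
    by (auto simp: act_tableau_def restrict_eq_iff)
qed

lemma act_tableau_one:
  assumes T: "T \<in> tableaux G n \<sigma>"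
  shows "act_tableau G \<sigma> \<one>\<^bsub>wreath G n\<^esub> T = T"
proof
  fix b
  show "act_tableau G \<sigma> \<one>\<^bsub>wreath G n\<^esub> T b = T b"
  proof (cases "b \<in> boxes G \<sigma>")
    case True
    obtain U r c where b: "b = (U, r, c)" by (metis surj_pair)
    show ?thesis
      using T True[unfolded b]
    proof (rule tableauxD)
      fix a i assume "T (U, r, c) = (U #> a, i)" "subgroup U G" "a \<in> carrier G" "i \<in> {1..n}"
      then show ?thesis
        using True
        by (simp add: b act_tableau_def act_entry_def one_wreath coset_mult_assoc subgroup.subset)
    qed
  next
    case False
    then show ?thesis
      using T PiE_arb[of T "boxes G \<sigma>"] by (auto simp: act_tableau_def tableaux_def)
  qed
qed

lemma act_tableau_row_equiv:
  assumes "(T, T') \<in> row_equiv G n \<sigma>" and w: "w \<in> carrier (wreath G n)"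
  shows "(act_tableau G \<sigma> w T, act_tableau G \<sigma> w T') \<in> row_equiv G n \<sigma>"
proof -
  have "row_entries G \<sigma> (act_tableau G \<sigma> w T) U r = act_entry G w ` row_entries G \<sigma> T U r" for T U r
    by (auto simp: row_entries_def act_tableau_def)
  then show ?thesis
    using assms act_tableau_closed[of _ n \<sigma> "fst w" "snd w"] by (auto simp: row_equiv_def)
qed

text \<open>This reduces the action on classes to representatives. To see that the image is a full
  class, a tableau equivalent to \<open>act_tableau G \<sigma> w T\<close> is pulled back by the
  inverse of \<open>w\<close>, which preserves row equivalence and so lands in the class of
  \<open>T\<close>.\<close>

lemma act_tabloid_class:
  assumes T: "T \<in> tableaux G n \<sigma>" and w: "w \<in> carrier (wreath G n)"
  shows "act_tabloid G \<sigma> w (row_equiv G n \<sigma> `` {T}) = row_equiv G n \<sigma> `` {act_tableau G \<sigma> w T}"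
proof
  show "act_tabloid G \<sigma> w (row_equiv G n \<sigma> `` {T}) \<subseteq> row_equiv G n \<sigma> `` {act_tableau G \<sigma> w T}"
    using act_tableau_row_equiv[OF _ w] by (auto simp: act_tabloid_def)
  show "row_equiv G n \<sigma> `` {act_tableau G \<sigma> w T} \<subseteq> act_tabloid G \<sigma> w (row_equiv G n \<sigma> `` {T})"
  proof
    interpret W: group "wreath G n" by (rule wreath_group)
    let ?v = "inv\<^bsub>wreath G n\<^esub> w"
    have mult: "act_tableau G \<sigma> x (act_tableau G \<sigma> y S) = act_tableau G \<sigma> (x \<otimes>\<^bsub>wreath G n\<^esub> y) S"
      if "S \<in> tableaux G n \<sigma>" "x \<in> carrier (wreath G n)" "y \<in> carrier (wreath G n)" for x y S
      using act_tableau_mult[of S n \<sigma> "fst x" "snd x" "fst y" "snd y"] that by simp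
    fix S assume S: "S \<in> row_equiv G n \<sigma> `` {act_tableau G \<sigma> w T}"
    then have "S \<in> tableaux G n \<sigma>" by (auto simp: row_equiv_def)
    moreover from S have "(act_tableau G \<sigma> ?v (act_tableau G \<sigma> w T), act_tableau G \<sigma> ?v S)
        \<in> row_equiv G n \<sigma>"
      using w by (auto intro: act_tableau_row_equiv)
    ultimately have "(T, act_tableau G \<sigma> ?v S) \<in> row_equiv G n \<sigma>"
      "S = act_tableau G \<sigma> w (act_tableau G \<sigma> ?v S)"
      using w T by (simp_all add: mult act_tableau_one)
    then show "S \<in> act_tabloid G \<sigma> w (row_equiv G n \<sigma> `` {T})"
      unfolding act_tabloid_def by blast
  qed
qed

lemma act_tabloid_mult:
  assumes t: "t \<in> tabloids G n \<sigma>" and v: "v \<in> carrier (wreath G n)"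
    and w: "w \<in> carrier (wreath G n)"
  shows "act_tabloid G \<sigma> w t \<in> tabloids G n \<sigma>"
    and "act_tabloid G \<sigma> v (act_tabloid G \<sigma> w t) = act_tabloid G \<sigma> (v \<otimes>\<^bsub>wreath G n\<^esub> w) t"
proof -
  interpret W: group "wreath G n" by (rule wreath_group)
  obtain T where T: "T \<in> tableaux G n \<sigma>" "t = row_equiv G n \<sigma> `` {T}"
    using t by (auto simp: tabloids_def elim: quotientE)
  have wT: "act_tableau G \<sigma> w T \<in> tableaux G n \<sigma>"
    using act_tableau_closed[OF T(1), of "fst w" "snd w"] w by simp
  then show "act_tabloid G \<sigma> w t \<in> tabloids G n \<sigma>"
    using T w by (simp add: act_tabloid_class tabloids_def quotientI)
  show "act_tabloid G \<sigma> v (act_tabloid G \<sigma> w t) = act_tabloid G \<sigma> (v \<otimes>\<^bsub>wreath G n\<^esub> w) t"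
    using T v w wT act_tableau_mult[OF T(1), of "fst v" "snd v" "fst w" "snd w"]
    by (simp add: act_tabloid_class)
qed

text \<open>The action is already transitive on tableaux. The indices of \<open>T\<close> and
  \<open>T'\<close> are bijections from the boxes to \<open>{1..n}\<close> and determine the
  permutation; in each box the two cosets belong to the same subgroup and differ by a translation,
  which supplies the base part.\<close>

lemma act_tabloid_transitive:
  assumes fin: "finite (carrier G)" and \<sigma>: "\<sigma> \<in> Sigma_types G n"
    and t: "t \<in> tabloids G n \<sigma>" and t': "t' \<in> tabloids G n \<sigma>"
  obtains w where "w \<in> carrier (wreath G n)" "act_tabloid G \<sigma> w t = t'"
proof -
  obtain T where T: "T \<in> tableaux G n \<sigma>" "t = row_equiv G n \<sigma> `` {T}"
    using t by (auto simp: tabloids_def elim: quotientE)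
  obtain T' where T': "T' \<in> tableaux G n \<sigma>" "t' = row_equiv G n \<sigma> `` {T'}"
    using t' by (auto simp: tabloids_def elim: quotientE)
  have bij: "bij_betw (snd \<circ> S) (boxes G \<sigma>) {1..n}" if S: "S \<in> tableaux G n \<sigma>" for S
  proof -
    have inj: "inj_on (snd \<circ> S) (boxes G \<sigma>)" using S by (simp add: tableaux_def)
    moreover have "(snd \<circ> S) ` boxes G \<sigma> \<subseteq> {1..n}"
    proof
      fix i assume "i \<in> (snd \<circ> S) ` boxes G \<sigma>"
      then obtain U r c where b: "(U, r, c) \<in> boxes G \<sigma>" "i = snd (S (U, r, c))" by auto
      from S b(1) show "i \<in> {1..n}" by (rule tableauxD) (use b in simp)
    qed
    moreover have "card ((snd \<circ> S) ` boxes G \<sigma>) = n"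
      using card_image[OF inj] card_boxes[OF fin \<sigma>] by simp
    ultimately show ?thesis by (simp add: bij_betw_def card_subset_eq)
  qed
  \<comment> \<open>\<open>B i\<close> is the box of \<open>T\<close> that holds the index
    \<open>i\<close>.\<close>
  define B where "B = inv_into (boxes G \<sigma>) (snd \<circ> T)"
  have B: "B (snd (T b)) = b" if "b \<in> boxes G \<sigma>" for b
    using bij_betw_inv_into_left[OF bij[OF T(1)] that] by (simp add: B_def)
  define s where "s = (\<lambda>i. if i \<in> {1..n} then snd (T' (B i)) else i)"
  have "bij_betw ((snd \<circ> T') \<circ> B) {1..n} {1..n}"
    unfolding B_def
    using bij_betw_trans[OF bij_betw_inv_into[OF bij[OF T(1)]] bij[OF T'(1)]] .
  then have "bij_betw s {1..n} {1..n}"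
    by (rule bij_betw_cong[THEN iffD1, rotated]) (simp add: s_def)
  then have s: "s permutes {1..n}"
    by (rule bij_imp_permutes) (simp add: s_def)
  have "\<exists>a\<in>carrier G. fst (T b) #> a = fst (T' b)" if mem: "b \<in> boxes G \<sigma>" for b
  proof -
    obtain U r c where b: "b = (U, r, c)" by (metis surj_pair)
    obtain x i where x: "T b = (U #> x, i)" "subgroup U G" "x \<in> carrier G"
      using tableauxD[OF T(1) mem[unfolded b]] b by metis
    obtain y j where y: "T' b = (U #> y, j)" "y \<in> carrier G"
      using tableauxD[OF T'(1) mem[unfolded b]] b by metis
    have "fst (T b) #> (inv x \<otimes> y) = fst (T' b)"
      using x y by (simp add: coset_mult_assoc subgroup.subset m_assoc[symmetric])
    then show ?thesis using x y by blast
  qed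
  then obtain a where a: "\<And>b. b \<in> boxes G \<sigma> \<Longrightarrow> a b \<in> carrier G"
    "\<And>b. b \<in> boxes G \<sigma> \<Longrightarrow> fst (T b) #> a b = fst (T' b)" by metis
  \<comment> \<open>The action reads \<open>g\<close> at the new index, so the translation for a box
    is stored at the image under \<open>s\<close> of the index that \<open>T\<close> has
    there.\<close>
  define g where "g = (\<lambda>i\<in>{1..n}. a (B (inv' s i)))"
  have B_mem: "B i \<in> boxes G \<sigma>" if "i \<in> {1..n}" for i
    using bij_betwE[OF bij_betw_inv_into[OF bij[OF T(1)]]] that by (simp add: B_def)
  have w: "(g, s) \<in> carrier (wreath G n)"
    using s a(1) B_mem by (auto simp: mem_wreath_iff g_def permutes_inv_mem_iff)
  have "act_tableau G \<sigma> (g, s) T b = T' b" for b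
  proof (cases "b \<in> boxes G \<sigma>")
    case True
    have i: "snd (T b) \<in> {1..n}" using bij_betwE[OF bij[OF T(1)]] True by simp
    then have "s (snd (T b)) \<in> {1..n}" using permutes_in_image[OF s] by simp
    then have "g (s (snd (T b))) = a b"
      using True permutes_inverses(2)[OF s] by (simp add: g_def B)
    moreover have "s (snd (T b)) = snd (T' b)" using i True by (simp add: s_def B)
    ultimately show ?thesis
      using True a by (simp add: act_tableau_def act_entry_def case_prod_unfold)
  next
    case False
    then show ?thesis
      using T'(1) PiE_arb[of T' "boxes G \<sigma>"] by (auto simp: act_tableau_def tableaux_def)
  qed
  then have "act_tableau G \<sigma> (g, s) T = T'" by blast
  then have "act_tabloid G \<sigma> (g, s) t = t'"
    using T T' w by (simp add: act_tabloid_class)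
  with w show ?thesis using that by blast
qed

section \<open>Cycle types of elements fixing a tabloid\<close>

lemma cycle_type_mem_Lambda_types:
  assumes fin: "finite (carrier G)" and w: "(g, p) \<in> carrier (wreath G n)"
  shows "cycle_type G n (g, p) \<in> Lambda_types G n"
proof -
  note p = wreath_memD(1)[OF w] and g = wreath_memD(2)[OF w]
  let ?S = "\<lambda>h. {C \<in> cycle_supports n p. cycle_sign G g C = h}"
  have fin_S: "finite (?S h)" for h using finite_cycle_supports[of n p] by simp
  have pos: "card C \<noteq> 0" if "C \<in> cycle_supports n p" for C
  proof -
    have "finite C" using cycle_supports_subset[OF p that] finite_subset by blast
    moreover have "C \<noteq> {}" using that orbit_nonempty[of p] by (auto simp: cycle_supports_def)
    ultimately show ?thesis by simp
  qed
  have sign: "cycle_sign G g C \<in> carrier G" if "C \<in> cycle_supports n p" for C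
    using g cycle_supports_subset[OF p that]
    unfolding cycle_sign_def by (intro finprod_closed) blast
  have "rev (sorted_list_of_multiset (image_mset card (mset_set (?S h)))) \<in> Par" for h
    using pos fin_S[of h] by (auto simp: Par_def sorted_wrt_rev image_iff)
  moreover have "(\<Sum>h\<in>carrier G. sum_list (cycle_type G n (g, p) h)) = n"
  proof -
    have "(\<Sum>h\<in>carrier G. sum_list (cycle_type G n (g, p) h)) = (\<Sum>h\<in>carrier G. \<Sum>C\<in>?S h. card C)"
    proof (rule sum.cong)
      fix h assume "h \<in> carrier G"
      have "sum_list (sorted_list_of_multiset M) = \<Sum>\<^sub># M" for M :: "nat multiset"
        by (metis mset_sorted_list_of_multiset sum_mset_sum_list)
      then show "sum_list (cycle_type G n (g, p) h) = (\<Sum>C\<in>?S h. card C)"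
        using \<open>h \<in> carrier G\<close> by (simp add: cycle_type_def sum_unfold_sum_mset)
    qed simp
    \<comment> \<open>Every cycle has exactly one sign, so the inner sums run over the fibres of
      \<open>cycle_sign\<close>.\<close>
    also have "\<dots> = (\<Sum>C\<in>cycle_supports n p. card C)"
      using sum.group[OF finite_cycle_supports fin, of "cycle_sign G g"] sign by blast
    finally show ?thesis using sum_card_cycle_supports[OF p] by simp
  qed
  ultimately show ?thesis by (auto simp: Lambda_types_def cycle_type_def)
qed

text \<open>The cycles of trivial sign alone provide \<open>n\<close> disjoint singletons, which
  exhaust \<open>{1..n}\<close>. So every point is fixed, and the sign of the cycle
  \<open>{i}\<close> is \<open>g i\<close> itself.\<close>

lemma cycle_type_one_eq_replicate_iff:
  assumes w: "(g, p) \<in> carrier (wreath G n)"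
  shows "cycle_type G n (g, p) \<one> = replicate n 1 \<longleftrightarrow> (g, p) = \<one>\<^bsub>wreath G n\<^esub>"
proof
  note p = wreath_memD(1)[OF w] and g = wreath_memD(2)[OF w]
  let ?S = "{C \<in> cycle_supports n p. cycle_sign G g C = \<one>}"
  have fin_S: "finite ?S" using finite_cycle_supports[of n p] by simp
  assume "cycle_type G n (g, p) \<one> = replicate n 1"
  then have "mset (cycle_type G n (g, p) \<one>) = mset (replicate n 1)" by simp
  then have M: "image_mset card (mset_set ?S) = replicate_mset n 1"
    by (simp add: cycle_type_def)
  then have card: "card C = 1" if "C \<in> ?S" for C
    using that fin_S by (metis (no_types, lifting) finite_set_mset_mset_set image_eqI in_replicate_mset set_image_mset)
  have "card ?S = n" using arg_cong[OF M, of size] by simp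
  have "card (\<Union>?S) = (\<Sum>C\<in>?S. card C)"
    using cycle_supports_disjoint[OF p] finite_subset[OF cycle_supports_subset[OF p]]
    by (intro card_Union_disjoint) (auto simp: pairwise_def disjnt_def)
  also have "\<dots> = n" using card \<open>card ?S = n\<close> by simp
  finally have "\<Union>?S = {1..n}"
    using cycle_supports_subset[OF p] by (intro card_subset_eq) auto
  have "p i = i \<and> g i = \<one>" if i: "i \<in> {1..n}" for i
  proof -
    obtain C where C: "C \<in> ?S" "i \<in> C" using i \<open>\<Union>?S = {1..n}\<close> by blast
    then have "C = {i}" using card[OF C(1)] by (metis card_1_singletonE singletonD)
    moreover have "p ` C = C" using image_cycle_support[OF p] C by blast
    ultimately show ?thesis using C(1) g[OF i] by (simp add: cycle_sign_def)
  qed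
  then have "p = id" "g = (\<lambda>i\<in>{1..n}. \<one>)"
    using permutes_not_in[OF p] w PiE_arb[of g "{1..n}"]
    by (fastforce simp: mem_wreath_iff fun_eq_iff restrict_def)+
  then show "(g, p) = \<one>\<^bsub>wreath G n\<^esub>" by (simp add: one_wreath)
next
  assume "(g, p) = \<one>\<^bsub>wreath G n\<^esub>"
  then have gp: "g = (\<lambda>i\<in>{1..n}. \<one>)" "p = id" by (simp_all add: one_wreath)
  have orbit: "Orbits.orbit id i = {i}" for i :: nat by (simp add: orbit_eq_singleton_iff)
  have supports: "cycle_supports n p = (\<lambda>i. {i}) ` {1..n}"
    by (simp add: cycle_supports_def gp orbit)
  then have "{C \<in> cycle_supports n p. cycle_sign G g C = \<one>} = (\<lambda>i. {i}) ` {1..n}"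
    by (auto simp: cycle_sign_def gp)
  moreover have "mset_set ((\<lambda>i. {i}) ` {1..n}) = image_mset (\<lambda>i. {i}) (mset_set {1..n})"
    by (simp add: image_mset_mset_set)
  ultimately have "image_mset card (mset_set {C \<in> cycle_supports n p. cycle_sign G g C = \<one>})
      = replicate_mset n 1"
    by (simp add: multiset.map_comp comp_def image_mset_const_eq flip: One_nat_def)
  moreover have "sorted_list_of_multiset (replicate_mset n (1::nat)) = replicate n 1"
    by (metis mset_replicate sorted_list_of_multiset_mset sorted_replicate sorted_sort_id)
  ultimately show "cycle_type G n (g, p) \<one> = replicate n 1"
    by (simp add: cycle_type_def)
qed

lemma fixes_tabloid_iff_cycle_type:
  assumes fin: "finite (carrier G)" and \<sigma>: "\<sigma> \<in> Sigma_types G n"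
    and t: "t \<in> tabloids G n \<sigma>" and w: "w \<in> carrier (wreath G n)"
  shows "(\<exists>t'\<in>tabloids G n \<sigma>. act_tabloid G \<sigma> w t' = t') \<longleftrightarrow>
    cycle_type G n w \<in> classes_meeting G n (tabloid_stabiliser G n \<sigma> t)"
proof
  interpret W: group "wreath G n" by (rule wreath_group)
  have type: "cycle_type G n w \<in> Lambda_types G n"
    using cycle_type_mem_Lambda_types[OF fin, of "fst w" "snd w"] w by simp
  assume "\<exists>t'\<in>tabloids G n \<sigma>. act_tabloid G \<sigma> w t' = t'"
  then obtain t' where t': "t' \<in> tabloids G n \<sigma>" "act_tabloid G \<sigma> w t' = t'" by blast
  obtain u where u: "u \<in> carrier (wreath G n)" "act_tabloid G \<sigma> u t' = t"
    using act_tabloid_transitive[OF fin \<sigma> t'(1) t] .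
  \<comment> \<open>The conjugate that fixes \<open>t\<close> when \<open>w\<close> fixes
    \<open>t'\<close>, as \<open>u\<close> moves \<open>t'\<close> to \<open>t\<close>.\<close>
  define v where "v = u \<otimes>\<^bsub>wreath G n\<^esub> w \<otimes>\<^bsub>wreath G n\<^esub> inv\<^bsub>wreath G n\<^esub> u"
  have v: "v \<in> carrier (wreath G n)" using u w by (simp add: v_def)
  have conj: "v \<otimes>\<^bsub>wreath G n\<^esub> u = u \<otimes>\<^bsub>wreath G n\<^esub> w"
    using u w by (simp add: v_def W.m_assoc)
  have "cycle_type G n v = cycle_type G n w"
    using conjugate_imp_cycle_type_eq[of "fst w" "snd w" n "fst v" "snd v" "fst u" "snd u"]
      u w v conj by simp
  moreover have "act_tabloid G \<sigma> v t = t"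
    using act_tabloid_mult(2)[OF t'(1) v u(1)] act_tabloid_mult(2)[OF t'(1) u(1) w] conj u t' by simp
  ultimately show "cycle_type G n w \<in> classes_meeting G n (tabloid_stabiliser G n \<sigma> t)"
    using v type by (auto simp: classes_meeting_def conj_class_def tabloid_stabiliser_def)
next
  assume "cycle_type G n w \<in> classes_meeting G n (tabloid_stabiliser G n \<sigma> t)"
  then obtain v where v: "v \<in> carrier (wreath G n)" "cycle_type G n v = cycle_type G n w"
    "act_tabloid G \<sigma> v t = t"
    by (auto simp: classes_meeting_def conj_class_def tabloid_stabiliser_def)
  obtain u where u: "u \<in> carrier (wreath G n)" "u \<otimes>\<^bsub>wreath G n\<^esub> v = w \<otimes>\<^bsub>wreath G n\<^esub> u"
    using cycle_type_eq_imp_conjugate[of "fst v" "snd v" n "fst w" "snd w"] v w by auto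
  \<comment> \<open>The tabloid fixed by \<open>w\<close> is the translate of \<open>t\<close> by
    the conjugating element.\<close>
  have "act_tabloid G \<sigma> w (act_tabloid G \<sigma> u t) = act_tabloid G \<sigma> u t"
    using act_tabloid_mult(2)[OF t w u(1)] act_tabloid_mult(2)[OF t u(1) v(1)] u v by simp
  then show "\<exists>t'\<in>tabloids G n \<sigma>. act_tabloid G \<sigma> w t' = t'"
    using act_tabloid_mult(1)[OF t u(1) u(1)] by blast
qed

end

section \<open>Cliques in terms of the inner distribution\<close>

theorem theorem4p10:
  fixes G :: "('a, 'm) monoid_scheme"
    and n :: nat
    and \<sigma> :: "'a set \<Rightarrow> nat list"
    and Y :: "((nat \<Rightarrow> 'a) \<times> (nat \<Rightarrow> nat)) set"
    and t :: "('a set \<times> nat \<times> nat \<Rightarrow> 'a set \<times> nat) set"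
  assumes "comm_group G"
    and "finite (carrier G)"
    and "n \<ge> 1"
    and "\<sigma> \<in> Sigma_types G n"
    and "Y \<subseteq> carrier (wreath G n)"
    and "Y \<noteq> {}"
    and "t \<in> tabloids G n \<sigma>"
  shows "is_clique G n \<sigma> Y \<longleftrightarrow>
    (\<forall>\<mu> \<in> classes_meeting G n (tabloid_stabiliser G n \<sigma> t).
      \<mu> \<one>\<^bsub>G\<^esub> \<noteq> replicate n 1 \<longrightarrow> inner_distribution G n Y \<mu> = 0)"
proof -
  interpret comm_group G by fact
  interpret W: group "wreath G n" by (rule wreath_group)
  let ?q = "\<lambda>x y. inv\<^bsub>wreath G n\<^esub> x \<otimes>\<^bsub>wreath G n\<^esub> y"
  have Y: "x \<in> carrier (wreath G n)" if "x \<in> Y" for x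
    using assms(5) that by blast
  have "finite Y"
    using finite_wreath[OF assms(2)] assms(5) by (rule finite_subset[rotated])
  \<comment> \<open>\<open>Y\<close> is finite and nonempty, so the quotient vanishes only if its
    numerator counts an empty set of pairs.\<close>
  have dist: "inner_distribution G n Y \<mu> = 0 \<longleftrightarrow>
      (\<forall>x\<in>Y. \<forall>y\<in>Y. ?q x y \<notin> conj_class G n \<mu>)" for \<mu>
  proof -
    let ?P = "{(x, y) \<in> Y \<times> Y. ?q x y \<in> conj_class G n \<mu>}"
    have "finite ?P"
      using \<open>finite Y\<close> by (intro finite_subset[of ?P "Y \<times> Y"]) auto
    then have "inner_distribution G n Y \<mu> = 0 \<longleftrightarrow> ?P = {}"
      using assms(6) \<open>finite Y\<close> by (simp add: inner_distribution_def)
    also have "\<dots> \<longleftrightarrow> (\<forall>x\<in>Y. \<forall>y\<in>Y. ?q x y \<notin> conj_class G n \<mu>)" by blast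
    finally show ?thesis .
  qed
  have fixes_iff: "(\<exists>t'\<in>tabloids G n \<sigma>. act_tabloid G \<sigma> w t' = t') \<longleftrightarrow>
      cycle_type G n w \<in> classes_meeting G n (tabloid_stabiliser G n \<sigma> t)"
    if "w \<in> carrier (wreath G n)" for w
    by (rule fixes_tabloid_iff_cycle_type[OF assms(2,4,7) that])
  have one_iff: "cycle_type G n (?q x y) \<one>\<^bsub>G\<^esub> = replicate n 1 \<longleftrightarrow> x = y" if "x \<in> Y" "y \<in> Y" for x y
  proof -
    have "cycle_type G n (?q x y) \<one>\<^bsub>G\<^esub> = replicate n 1 \<longleftrightarrow> ?q x y = \<one>\<^bsub>wreath G n\<^esub>"
      using cycle_type_one_eq_replicate_iff[of "fst (?q x y)" "snd (?q x y)"] that by (simp add: Y)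
    also have "\<dots> \<longleftrightarrow> x = y"
      using that Y by (metis W.inv_closed W.inv_equality W.inv_inv W.l_inv)
    finally show ?thesis .
  qed
  have class_iff: "?q x y \<in> conj_class G n \<mu> \<longleftrightarrow> cycle_type G n (?q x y) = \<mu>"
    if "x \<in> Y" "y \<in> Y" for x y \<mu>
    using that Y by (simp add: conj_class_def)
  have "is_clique G n \<sigma> Y \<longleftrightarrow> (\<forall>x\<in>Y. \<forall>y\<in>Y. x \<noteq> y \<longrightarrow>
      cycle_type G n (?q x y) \<notin> classes_meeting G n (tabloid_stabiliser G n \<sigma> t))"
    using assms(5,6) fixes_iff Y by (auto simp: is_clique_def)
  \<comment> \<open>Each ordered pair contributes to exactly one class, that of its quotient. By
    \<open>one_iff\<close> the condition on \<mu> at the unit discards precisely the pairs with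
    \<open>x = y\<close>.\<close>
  also have "\<dots> \<longleftrightarrow> (\<forall>\<mu> \<in> classes_meeting G n (tabloid_stabiliser G n \<sigma> t).
      \<mu> \<one>\<^bsub>G\<^esub> \<noteq> replicate n 1 \<longrightarrow> inner_distribution G n Y \<mu> = 0)"
    unfolding dist using one_iff class_iff by metis
  finally show ?thesis .
qed

end
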